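(* For every positive integer $n$: (a) $M_2(S_n\times S_n)\ge (n-1)!$; (b) $M_{2,n}(S_n\times S_n)\ge n!$; (c) $M_2(A_n\times A_n)\ge (n-1)!/2$; (d) $M_{2,n}(A_n\times A_n)\ge n!/2$.
   Context: For a group $\Gamma$ and positive integers $k,g$, a set $A\subseteq\Gamma$ is an $S_k[g]$-set if for every $\mu\in\Gamma$ there are at most $g$ words $(\alpha_1,\ldots,\alpha_k)\in A^k$ with $\alpha_1\cdots\alpha_k=\mu$; an $S_k$-set is an $S_k[1]$-set. $M_{k,g}(\Gamma)$ is the maximum size of an $S_k[g]$-set in $\Gamma$, and $M_k(\Gamma)=M_{k,1}(\Gamma)$. $S_n$ and $A_n$ are the symmetric and alternating groups on $n$ letters. *)

theory Defs
  imports Complex_Main "HOL-Algebra.Sym_Groups"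
begin

definition word_prod :: "('a, 'b) monoid_scheme \<Rightarrow> 'a list \<Rightarrow> 'a" where
  "word_prod G w = foldr (mult G) w (one G)"

text \<open>
  Finiteness of the set of words is demanded explicitly, because the cardinality of an
  infinite set is 0 in HOL.
\<close>

definition S_set :: "('a, 'b) monoid_scheme \<Rightarrow> nat \<Rightarrow> nat \<Rightarrow> 'a set \<Rightarrow> bool" where
  "S_set G k g A \<longleftrightarrow>
     A \<subseteq> carrier G \<and>
     (\<forall>\<mu> \<in> carrier G.
        finite {w. length w = k \<and> set w \<subseteq> A \<and> word_prod G w = \<mu>} \<and>
        card {w. length w = k \<and> set w \<subseteq> A \<and> word_prod G w = \<mu>} \<le> g)"

text \<open>
  The maximum is taken as a natural number, so it is meaningful only for groups with
  finite carrier (where the set below is finite, and non-empty since the empty set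
  qualifies for positive \<open>k\<close>).
\<close>

definition max_S_set_size :: "nat \<Rightarrow> nat \<Rightarrow> ('a, 'b) monoid_scheme \<Rightarrow> nat" where
  "max_S_set_size k g G = Max {card A |A. S_set G k g A}"

abbreviation max_S1_set_size :: "nat \<Rightarrow> ('a, 'b) monoid_scheme \<Rightarrow> nat" where
  "max_S1_set_size k G \<equiv> max_S_set_size k 1 G"

end

theory Submission
  imports Defs
begin

text \<open>
  For a fixed \<open>c\<close> take all pairs \<open>(x, x c)\<close>. If \<open>x y = \<mu>\<close> and \<open>x c y c = \<nu>\<close>, then
  \<open>x c x\<^sup>-\<^sup>1 = \<nu> c\<^sup>-\<^sup>1 \<mu>\<^sup>-\<^sup>1\<close>, so \<open>x\<close> is determined up to the centralizer of \<open>c\<close>.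
  When \<open>c\<close> is a cycle of length \<open>n\<close> or \<open>n - 1\<close> through the point 1, an element of the
  centralizer fixing 1 is trivial; hence \<open>x\<close> is determined by its value at 1. Letting \<open>x\<close> range
  over the whole group gives the bound \<open>n\<close> on the number of words, and letting it range over the
  stabilizer of 1, whose index is at most \<open>n\<close>, gives the bound 1. For the alternating
  group, the one of the two cycle lengths that is odd is chosen.
\<close>

section \<open>Twisted diagonals as \<open>S_set\<close>s of a direct square\<close>

lemma card_le_max_S_set_size:
  assumes "finite (carrier G)" and "S_set G k g A"
  shows "card A \<le> max_S_set_size k g G"
proof -
  have "{card A |A. S_set G k g A} \<subseteq> card ` Pow (carrier G)"
    by (auto simp: S_set_def)
  then have "finite {card A |A. S_set G k g A}"
    using assms(1) finite_subset by fastforce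
  with assms(2) show ?thesis
    unfolding max_S_set_size_def by (intro Max_ge) auto
qed

text \<open>Two words with the same product have first letters \<open>x\<close> and
  \<open>x \<otimes> z\<close>. The first equation gives \<open>y = z \<otimes> y'\<close>;
  substituted into the second, it leaves \<open>x\<close> to cancel on the left and
  \<open>y' \<otimes> c\<close> on the right.\<close>

lemma (in group) commutes_if_twisted_products_eq:
  assumes carr: "x \<in> carrier G" "y \<in> carrier G" "z \<in> carrier G" "y' \<in> carrier G" "c \<in> carrier G"
    and prod: "x \<otimes> y = (x \<otimes> z) \<otimes> y'"
    and twisted: "(x \<otimes> c) \<otimes> (y \<otimes> c) = ((x \<otimes> z) \<otimes> c) \<otimes> (y' \<otimes> c)"
  shows "c \<otimes> z = z \<otimes> c"
proof -
  have y: "y = z \<otimes> y'"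
    using prod carr by (simp add: m_assoc)
  have "x \<otimes> ((c \<otimes> z) \<otimes> (y' \<otimes> c)) = x \<otimes> ((z \<otimes> c) \<otimes> (y' \<otimes> c))"
    using twisted carr unfolding y by (simp add: m_assoc)
  then have "(c \<otimes> z) \<otimes> (y' \<otimes> c) = (z \<otimes> c) \<otimes> (y' \<otimes> c)"
    using carr by (simp only: Units_eq Units_l_cancel m_closed)
  then show ?thesis
    using carr by (simp only: right_cancel m_closed)
qed

text \<open>The map \<open>h\<close> is a label separating elements of \<open>B\<close> that differ
  by a right factor centralizing \<open>c\<close>. Words with a given product are then distinguished
  by the label of their first letter, so there are at most as many words as labels.\<close>

lemma (in group) S_set_twisted_diagonal:
  fixes h :: "'a \<Rightarrow> 'c"
  assumes c: "c \<in> carrier G" and B: "B \<subseteq> carrier G"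
    and fin: "finite (h ` B)" and card: "card (h ` B) \<le> g"
    and triv: "\<And>x z. \<lbrakk>x \<in> B; z \<in> carrier G; x \<otimes> z \<in> B; c \<otimes> z = z \<otimes> c; h (x \<otimes> z) = h x\<rbrakk>
                 \<Longrightarrow> z = \<one>"
  shows "S_set (G \<times>\<times> G) 2 g ((\<lambda>x. (x, x \<otimes> c)) ` B)"
  unfolding S_set_def
proof (intro conjI ballI)
  let ?A = "(\<lambda>x. (x, x \<otimes> c)) ` B"
  show "?A \<subseteq> carrier (G \<times>\<times> G)"
    using B c by auto
  fix \<mu> assume "\<mu> \<in> carrier (G \<times>\<times> G)"
  define W where "W = {w. length w = 2 \<and> set w \<subseteq> ?A \<and> word_prod (G \<times>\<times> G) w = \<mu>}"
  have W: "\<exists>x\<in>B. \<exists>y\<in>B. w = [(x, x \<otimes> c), (y, y \<otimes> c)] \<and> \<mu> = (x \<otimes> y, (x \<otimes> c) \<otimes> (y \<otimes> c))"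
    if w: "w \<in> W" for w
  proof -
    have "length w = 2"
      using w by (simp add: W_def)
    then obtain u v where uv: "w = [u, v]"
      by (auto simp: numeral_2_eq_2 length_Suc_conv)
    then have "u \<in> ?A" "v \<in> ?A" "word_prod (G \<times>\<times> G) [u, v] = \<mu>"
      using w by (auto simp: W_def)
    then show ?thesis
      using uv B c by (auto simp: word_prod_def DirProd_def subset_iff)
  qed
  have inj: "inj_on (\<lambda>w. h (fst (hd w))) W"
  proof (rule inj_onI)
    fix w w' assume "w \<in> W" "w' \<in> W" and h: "h (fst (hd w)) = h (fst (hd w'))"
    then obtain x y x' y' where w: "w = [(x, x \<otimes> c), (y, y \<otimes> c)]" and w': "w' = [(x', x' \<otimes> c), (y', y' \<otimes> c)]"
      and in_B: "x \<in> B" "y \<in> B" "x' \<in> B" "y' \<in> B"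
      and eq: "x \<otimes> y = x' \<otimes> y'" "(x \<otimes> c) \<otimes> (y \<otimes> c) = (x' \<otimes> c) \<otimes> (y' \<otimes> c)"
      using W[of w] W[of w'] by auto
    have carr: "x \<in> carrier G" "y \<in> carrier G" "x' \<in> carrier G" "y' \<in> carrier G"
      using in_B B by auto
    \<comment> \<open>The quotient of the two first letters; it commutes with \<open>c\<close>, so
      equal labels force it to be trivial.\<close>
    define z where "z = inv x \<otimes> x'"
    have z: "z \<in> carrier G" "x' = x \<otimes> z"
      using carr by (simp_all add: z_def m_assoc[symmetric])
    have "c \<otimes> z = z \<otimes> c"
      using commutes_if_twisted_products_eq[of x y z y' c] carr z c eq by simp
    then have "z = \<one>"
      using triv[of x z] in_B z h w w' by simp
    then have "x = x'"
      using z carr by simp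
    moreover have "y = y'"
      using eq(1) carr unfolding \<open>x = x'\<close> by simp
    ultimately show "w = w'"
      using w w' by simp
  qed
  have sub: "(\<lambda>w. h (fst (hd w))) ` W \<subseteq> h ` B"
    using W by fastforce
  show "finite {w. length w = 2 \<and> set w \<subseteq> ?A \<and> word_prod (G \<times>\<times> G) w = \<mu>}"
    using inj_on_finite[OF inj sub fin] by (simp add: W_def)
  show "card {w. length w = 2 \<and> set w \<subseteq> ?A \<and> word_prod (G \<times>\<times> G) w = \<mu>} \<le> g"
    using card_inj_on_le[OF inj sub fin] card by (simp add: W_def)
qed

lemma (in group) card_le_max_S_set_size_twisted_diagonal:
  fixes h :: "'a \<Rightarrow> 'c"
  assumes "finite (carrier G)" and "c \<in> carrier G" and "B \<subseteq> carrier G"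
    and "finite (h ` B)" and "card (h ` B) \<le> g"
    and "\<And>x z. \<lbrakk>x \<in> B; z \<in> carrier G; x \<otimes> z \<in> B; c \<otimes> z = z \<otimes> c; h (x \<otimes> z) = h x\<rbrakk> \<Longrightarrow> z = \<one>"
  shows "card B \<le> max_S_set_size 2 g (G \<times>\<times> G)"
proof -
  have "finite (carrier (G \<times>\<times> G))"
    using assms(1) by simp
  moreover have "S_set (G \<times>\<times> G) 2 g ((\<lambda>x. (x, x \<otimes> c)) ` B)"
    using assms(2-) by (rule S_set_twisted_diagonal)
  ultimately have "card ((\<lambda>x. (x, x \<otimes> c)) ` B) \<le> max_S_set_size 2 g (G \<times>\<times> G)"
    by (rule card_le_max_S_set_size)
  then show ?thesis
    by (simp add: card_image inj_on_def)
qed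

section \<open>An explicit cycle and its centralizer\<close>

text \<open>The cycle \<open>(1 2 \<dots> k+1)\<close>, of length one more than the argument.\<close>

primrec initial_cycle :: "nat \<Rightarrow> nat \<Rightarrow> nat" where
  "initial_cycle 0 = id"
| "initial_cycle (Suc k) = initial_cycle k \<circ> transpose (Suc k) (Suc (Suc k))"

lemma initial_cycle_permutes: "initial_cycle k permutes {1..Suc k}"
proof (induction k)
  case 0
  then show ?case
    by (simp only: initial_cycle.simps permutes_id)
next
  case (Suc k)
  have "initial_cycle k permutes {1..Suc (Suc k)}"
    using Suc by (rule permutes_subset) auto
  moreover have "transpose (Suc k) (Suc (Suc k)) permutes {1..Suc (Suc k)}"
    by (rule permutes_swap_id) auto
  ultimately show ?case
    by (simp only: initial_cycle.simps permutes_compose)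
qed

lemma initial_cycle_apply: "\<lbrakk>1 \<le> i; i \<le> k\<rbrakk> \<Longrightarrow> initial_cycle k i = Suc i"
proof (induction k)
  case (Suc k)
  show ?case
  proof (cases "i = Suc k")
    case True
    \<comment> \<open>The transposition acts first and moves \<open>Suc k\<close> to a point that
      the shorter cycle fixes.\<close>
    have "initial_cycle k (Suc (Suc k)) = Suc (Suc k)"
      using initial_cycle_permutes[of k] by (rule permutes_not_in) simp
    with True show ?thesis
      by simp
  qed (use Suc in \<open>simp add: transpose_def\<close>)
qed simp

lemma evenperm_initial_cycle: "evenperm (initial_cycle k) \<longleftrightarrow> even k"
proof (induction k)
  case (Suc k)
  have "permutation (initial_cycle k)"
    using initial_cycle_permutes[of k] by (auto simp: permutation_permutes)
  then show ?case
    using Suc by (simp add: evenperm_comp permutation_swap_id evenperm_swap del: o_apply comp_apply)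
qed simp

text \<open>Commuting with the cycle carries the fixed point 1 along the whole cycle
  \<open>1, ..., k + 1\<close>. Since \<open>n \<le> k + 2\<close>, at most one point of
  \<open>{1..n}\<close> lies outside the cycle, and a permutation fixing all the others fixes it
  too.\<close>

lemma centralizer_initial_cycle_fixing_1:
  assumes z: "z permutes {1..n}" and comm: "initial_cycle k \<circ> z = z \<circ> initial_cycle k"
    and z1: "z 1 = 1" and n: "n \<le> k + 2"
  shows "z = id"
proof
  have fix_le: "1 \<le> i \<Longrightarrow> i \<le> Suc k \<Longrightarrow> z i = i" for i
  proof (induction i rule: dec_induct)
    case base
    show ?case by (rule z1)
  next
    case (step i)
    then have "initial_cycle k i = Suc i"
      by (intro initial_cycle_apply) auto
    then show ?case
      using fun_cong[OF comm, of i] step by simp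
  qed
  fix i
  consider "i \<notin> {1..n}" | "1 \<le> i" "i \<le> Suc k" | "i = k + 2" "n = k + 2"
    using n by fastforce
  then show "z i = id i"
  proof cases
    case 1
    then show ?thesis using permutes_not_in[OF z] by simp
  next
    case 2
    then show ?thesis using fix_le by simp
  next
    case 3
    then have "z i \<in> {1..n}"
      using permutes_in_image[OF z] by simp
    moreover have "\<not> z i \<le> Suc k"
    proof
      assume "z i \<le> Suc k"
      with calculation have "z (z i) = z i"
        by (intro fix_le) auto
      then have "z i = i"
        using permutes_inj[OF z] by (auto dest: injD)
      with \<open>z i \<le> Suc k\<close> 3 show False by simp
    qed
    ultimately show ?thesis
      using 3 by simp
  qed
qed

section \<open>Finite permutation groups, treating the symmetric and alternating cases at
  once\<close>

locale permutation_group = group G for G :: "('p \<Rightarrow> 'p) monoid" (structure) +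
  fixes S :: "'p set"
  assumes finite_S: "finite S"
    and permutes: "x \<in> carrier G \<Longrightarrow> x permutes S"
    and mult_eq_comp: "mult G = (\<circ>)"
    and one_eq_id: "\<one> = id"
begin

lemma finite_carrier: "finite (carrier G)"
  by (rule finite_subset[OF _ finite_permutations[OF finite_S]]) (auto dest: permutes)

text \<open>The group splits into fibres according to the image of \<open>p\<close>. A nonempty
  fibre is translated into the stabilizer by the inverse of one of its elements; fibres may be
  empty, hence an inequality.\<close>

lemma card_le_mult_card_point_stabilizer:
  assumes p: "p \<in> S"
  shows "card (carrier G) \<le> card S * card {x \<in> carrier G. x p = p}"
proof -
  let ?F = "\<lambda>q. {x \<in> carrier G. x p = q}"
  have fibre: "card (?F q) \<le> card (?F p)" for q
  proof (cases "?F q = {}")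
    case False
    then obtain y where y: "y \<in> carrier G" "y p = q" by auto
    have "(inv y \<otimes> x) p = p" if "x \<in> ?F q" for x
    proof -
      have "(inv y \<otimes> x) p = (inv y \<otimes> y) p"
        using that y by (simp add: mult_eq_comp)
      then show ?thesis using y one_eq_id by simp
    qed
    then have "(\<lambda>x. inv y \<otimes> x) ` ?F q \<subseteq> ?F p"
      using y by auto
    moreover have "inj_on (\<lambda>x. inv y \<otimes> x) (?F q)"
      using y by (intro inj_onI) auto
    ultimately show ?thesis
      using finite_carrier by (intro card_inj_on_le) auto
  next
    case True
    then show ?thesis by (simp only: card.empty zero_le)
  qed
  have "carrier G = (\<Union>q\<in>S. ?F q)"
    using p by (auto simp: permutes_in_image[OF permutes])
  then have "card (carrier G) \<le> (\<Sum>q\<in>S. card (?F q))"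
    using card_UN_le[OF finite_S, of ?F] by simp
  also have "\<dots> \<le> (\<Sum>q\<in>S. card (?F p))"
    using fibre by (intro sum_mono)
  finally show ?thesis by simp
qed

end

text \<open>Evaluation at 1 serves as the label. It is constant on the stabilizer of 1 and takes at
  most \<open>n\<close> values on the whole group, giving the two bounds.\<close>

lemma permutation_group_max_S_set_sizes:
  fixes G (structure)
  assumes G: "permutation_group G {1..n}"
    and n: "1 \<le> n" "n \<le> k + 2" and c: "initial_cycle k \<in> carrier G"
  shows "card (carrier G) \<le> n * max_S_set_size 2 1 (G \<times>\<times> G)"
    and "card (carrier G) \<le> max_S_set_size 2 n (G \<times>\<times> G)"
proof -
  interpret permutation_group G "{1..n}"
    by (rule G)
  have triv: "z = \<one>"
    if "x \<in> carrier G" "z \<in> carrier G" "initial_cycle k \<otimes> z = z \<otimes> initial_cycle k"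
      "(x \<otimes> z) 1 = x 1" for x z
  proof -
    \<comment> \<open>Here \<open>x (z 1) = x 1\<close>, and \<open>x\<close> is injective.\<close>
    have "z 1 = 1"
      using that permutes_inj[OF permutes[of x]] by (auto simp: mult_eq_comp dest: injD)
    then show ?thesis
      using centralizer_initial_cycle_fixing_1[of z n k] permutes that n one_eq_id by (simp add: mult_eq_comp)
  qed
  let ?B = "{x \<in> carrier G. x 1 = 1}"
  have "card ?B \<le> max_S_set_size 2 1 (G \<times>\<times> G)"
  proof (rule card_le_max_S_set_size_twisted_diagonal[OF finite_carrier c, where h = "\<lambda>x. x 1"])
    have sub: "(\<lambda>x. x 1) ` ?B \<subseteq> {1}" by auto
    then show "finite ((\<lambda>x. x 1) ` ?B)"
      using finite_subset by blast
    show "card ((\<lambda>x. x 1) ` ?B) \<le> 1"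
      using card_mono[OF _ sub] by simp
  qed (use triv in auto)
  moreover have "card (carrier G) \<le> n * card ?B"
    using card_le_mult_card_point_stabilizer[of 1] n by simp
  ultimately show "card (carrier G) \<le> n * max_S_set_size 2 1 (G \<times>\<times> G)"
    by (meson mult_le_mono2 order_trans)
  show "card (carrier G) \<le> max_S_set_size 2 n (G \<times>\<times> G)"
  proof (rule card_le_max_S_set_size_twisted_diagonal[OF finite_carrier c, where h = "\<lambda>x. x 1"])
    have sub: "(\<lambda>x. x 1) ` carrier G \<subseteq> {1..n}"
      using n by (auto simp: permutes_in_image[OF permutes, simplified])
    then show "finite ((\<lambda>x. x 1) ` carrier G)"
      using finite_subset by blast
    show "card ((\<lambda>x. x 1) ` carrier G) \<le> n"
      using card_mono[OF _ sub] by simp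
  qed (use triv in auto)
qed

section \<open>The symmetric and alternating groups\<close>

lemma permutation_group_sym_group: "permutation_group (sym_group n) {1..n}"
  by (intro permutation_group.intro sym_group_is_group permutation_group_axioms.intro)
    (simp_all add: sym_group_def)

lemma permutation_group_alt_group: "permutation_group (alt_group n) {1..n}"
  by (intro permutation_group.intro alt_group_is_group permutation_group_axioms.intro)
    (simp_all add: alt_group_carrier alt_group_mult alt_group_one)

theorem theorem1p8:
  fixes n :: nat
  assumes "n \<ge> 1"
  shows "max_S1_set_size 2 (sym_group n \<times>\<times> sym_group n) \<ge> fact (n - 1) \<and>
         max_S_set_size 2 n (sym_group n \<times>\<times> sym_group n) \<ge> fact n \<and>
         real (max_S1_set_size 2 (alt_group n \<times>\<times> alt_group n)) \<ge> fact (n - 1) / 2 \<and>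
         real (max_S_set_size 2 n (alt_group n \<times>\<times> alt_group n)) \<ge> fact n / 2"
proof -
  have fact_n: "fact n = n * (fact (n - 1) :: nat)"
    using assms by (simp add: fact_reduce)
  have cycle_permutes: "initial_cycle k permutes {1..n}" if "k < n" for k
    using initial_cycle_permutes by (rule permutes_subset) (use that in auto)
  have sym_carrier: "initial_cycle (n - 1) \<in> carrier (sym_group n)"
    using cycle_permutes assms by (simp add: sym_group_carrier)
  have sym_card: "card (carrier (sym_group n)) = fact n"
    by (rule sym_group_card_carrier)
  note sym = permutation_group_max_S_set_sizes[OF permutation_group_sym_group assms _ sym_carrier]
  have sym1: "fact n \<le> n * max_S_set_size 2 1 (sym_group n \<times>\<times> sym_group n)"
    using sym(1) sym_card by simp
  have sym2: "fact n \<le> max_S_set_size 2 n (sym_group n \<times>\<times> sym_group n)"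
    using sym(2) sym_card by simp
  \<comment> \<open>The cycle has length \<open>k + 1\<close>, so \<open>k\<close> must be even for
    it to lie in the alternating group; it omits the point \<open>n\<close> exactly when
    \<open>n\<close> is even.\<close>
  define k where "k = (if odd n then n - 1 else n - 2)"
  have k: "k < n" "n \<le> k + 2" "even k"
    using assms by (auto simp: k_def)
  have alt_carrier: "initial_cycle k \<in> carrier (alt_group n)"
    using cycle_permutes[OF k(1)] k(3) by (simp add: alt_group_carrier evenperm_initial_cycle)
  have alt_card: "fact n \<le> 2 * card (carrier (alt_group n))"
  \<comment> \<open>For \<open>n = 1\<close> the alternating group is trivial and its order is 1,
    not \<open>fact n / 2\<close>; the inequality still holds.\<close>
  proof (cases "n = 1")
    case True
    have "finite (carrier (alt_group n))"
      using permutation_group_alt_group by (rule permutation_group.finite_carrier)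
    with alt_carrier have "0 < card (carrier (alt_group n))"
      by (auto simp: card_gt_0_iff)
    with True show ?thesis by simp
  next
    case False
    then show ?thesis
      using alt_group_card_carrier[of n] assms by simp
  qed
  note alt = permutation_group_max_S_set_sizes[OF permutation_group_alt_group assms k(2) alt_carrier]
  have "card (carrier (alt_group n)) \<le> n * max_S_set_size 2 1 (alt_group n \<times>\<times> alt_group n)"
    by (rule alt(1))
  then have alt1: "fact n \<le> n * (2 * max_S_set_size 2 1 (alt_group n \<times>\<times> alt_group n))"
    using alt_card by simp
  have "card (carrier (alt_group n)) \<le> max_S_set_size 2 n (alt_group n \<times>\<times> alt_group n)"
    by (rule alt(2))
  then have alt2: "fact n \<le> 2 * max_S_set_size 2 n (alt_group n \<times>\<times> alt_group n)"
    using alt_card by simp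
  \<comment> \<open>The positive factor \<open>n\<close> cancels from both sides.\<close>
  have "fact (n - 1) \<le> max_S_set_size 2 1 (sym_group n \<times>\<times> sym_group n)"
    using sym1 assms unfolding fact_n by simp
  moreover have "fact (n - 1) \<le> 2 * max_S_set_size 2 1 (alt_group n \<times>\<times> alt_group n)"
    using alt1 assms unfolding fact_n by simp
  then have "fact (n - 1) \<le> 2 * real (max_S_set_size 2 1 (alt_group n \<times>\<times> alt_group n))"
    by (metis of_nat_fact of_nat_le_iff of_nat_mult of_nat_numeral)
  moreover have "fact n \<le> 2 * real (max_S_set_size 2 n (alt_group n \<times>\<times> alt_group n))"
    using alt2 by (metis of_nat_fact of_nat_le_iff of_nat_mult of_nat_numeral)
  ultimately show ?thesis
    using sym2 by simp
qed

end
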